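(* For $n=0,1,2,\ldots$ let $a_n=\sum_{k=0}^n\binom nk^2C_k$, where $C_k$ denotes the Catalan number $\binom{2k}k/(k+1)=\binom{2k}k-\binom{2k}{k+1}$. Then, for any odd prime $p$ we have $$a_1+\cdots+a_{p-1}\equiv0\pmod{p^2}.$$ *)

theory Defs
  imports "HOL-Number_Theory.Number_Theory"
begin

definition catalan :: "nat \<Rightarrow> nat" where
  "catalan k = ((2 * k) choose k) div (k + 1)"

text \<open>The natural number division in \<^const>\<open>catalan\<close> is exact, and the truncated
  subtraction in \<open>catalan_eq_diff\<close> below never truncates.\<close>

lemma Suc_times_central_binomial:
  "(k + 1) * ((2 * k) choose (k + 1)) = k * ((2 * k) choose k)"
proof -
  have "Suc k * ((2 * k) choose Suc k) = (2 * k - k) * ((2 * k) choose k)"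
    by (metis binomial_absorb_comp binomial_absorption mult.commute)
  then show ?thesis by simp
qed

lemma central_binomial_ge: "((2 * k) choose (k + 1)) \<le> ((2 * k) choose k)"
  using binomial_maximum'[of k "k + 1"] by simp

lemma central_binomial_eq_diff:
  "((2 * k) choose k) = (k + 1) * (((2 * k) choose k) - ((2 * k) choose (k + 1)))"
  using Suc_times_central_binomial[of k] by (simp add: diff_mult_distrib2)

lemma catalan_eq_diff: "catalan k = ((2 * k) choose k) - ((2 * k) choose (k + 1))"
  unfolding catalan_def
  by (metis central_binomial_eq_diff nonzero_mult_div_cancel_left add_is_0 one_neq_zero)

lemma Suc_times_catalan: "(k + 1) * catalan k = (2 * k) choose k"
  using central_binomial_eq_diff[of k] catalan_eq_diff[of k] by simp

definition catalan_sum :: "nat \<Rightarrow> nat" where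
  "catalan_sum n = (\<Sum>k = 0..n. (n choose k)^2 * catalan k)"

end

theory Submission
  imports Defs
begin

text \<open>Exchanging the order of summation turns \<open>a\<^sub>0 + \<dots> + a\<^sub>p\<^sub>-\<^sub>1\<close> into \<open>\<Sum>k<p. x\<^sub>k\<close> with
  \<open>x\<^sub>k = C\<^sub>k T\<^sub>k\<close>, where \<open>C\<^sub>k\<close> is a Catalan number and \<open>T\<^sub>k = \<Sum>n<p. (n choose k)\<^sup>2\<close>. Put
  \<open>p = 2h + 1\<close>. The point is that every single \<open>x\<^sub>k\<close> has a simple closed form modulo \<open>p\<^sup>2\<close>.

  For \<open>k \<le> h\<close>, repeated summation by parts moves all differences from one factor of
  \<open>(n choose k)\<^sup>2\<close> to the other. Each boundary term is a product of two multiples of \<open>p\<close>, so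
  \<open>T\<^sub>k \<equiv> (-1)\<^sup>k (p + k choose 2k + 1)\<close>
  (\<open>column_square_sum_cong_choose\<close>). Together with
  \<open>(p - 1 choose k) (p + k choose k) = \<Prod>\<^sub>i\<^sub>\<le>\<^sub>k (p\<^sup>2 / i\<^sup>2 - 1) \<equiv> (-1)\<^sup>k\<close> this gives
  \<open>x\<^sub>k \<equiv> p / ((k + 1)(2k + 1))\<close> for \<open>k < h\<close> and \<open>x\<^sub>h \<equiv> 1 / (h + 1) \<equiv> 2 - 2p\<close>.

  For \<open>k = p - 1 - i\<close> with \<open>0 < i < h\<close> the Catalan number is already divisible by \<open>p\<close>, so
  \<open>T\<^sub>k\<close> matters only modulo \<open>p\<close>. There \<open>p - 1 - s\<close> behaves like \<open>-1 - s\<close>, and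
  \<open>T\<^sub>k \<equiv> \<Sum>s\<le>i. (i choose s)\<^sup>2 = (2i choose i)\<close>. The product of this with the central
  binomial coefficient of \<open>k\<close> is \<open>-p / (2i + 1)\<close>, whence \<open>x\<^sub>k \<equiv> p / (i(2i + 1))\<close>. Finally
  \<open>x\<^sub>p\<^sub>-\<^sub>1\<close> is a Catalan number, and \<open>(2p choose p) \<equiv> 2\<close> gives \<open>x\<^sub>p\<^sub>-\<^sub>1 \<equiv> -1 - 2p\<close>.

  Now \<open>x\<^sub>i + x\<^sub>p\<^sub>-\<^sub>1\<^sub>-\<^sub>i \<equiv> p / (i(i + 1))\<close> for \<open>0 < i < h\<close>, and these terms telescope to
  \<open>p (1 - 1/h) \<equiv> 3p\<close>. The total is \<open>p + 3p + (2 - 2p) + (-1 - 2p) = 1\<close>, which is \<open>a\<^sub>0\<close>.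

  All these fractions have denominators coprime to \<open>p\<close>; the lemmas state them as integer
  congruences with the denominators multiplied out.\<close>

section \<open>Congruences and finite sums\<close>

lemma cong_mult_dvd_square_modulus:
  fixes a b c p :: int
  assumes "p dvd c" "[a = b] (mod p)"
  shows "[c * a = c * b] (mod p^2)"
  using assms
  by (auto simp: cong_iff_dvd_diff power2_eq_square simp flip: right_diff_distrib intro: mult_dvd_mono)

lemma sum_pair_reflect:
  fixes f :: "nat \<Rightarrow> 'a::comm_monoid_add"
  shows "(\<Sum>k<2 * h + 1. f k) = (\<Sum>k<h. f k + f (2 * h - k)) + f h"
proof -
  have "(\<Sum>k<2 * h + 1. f k) = (\<Sum>k\<in>{..<h} \<union> {h} \<union> {h<..2 * h}. f k)"
    by (rule sum.cong) auto
  also have "\<dots> = (\<Sum>k<h. f k) + f h + (\<Sum>k\<in>{h<..2 * h}. f k)"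
    by (subst sum.union_disjoint, simp, simp, force)+ (simp add: add_ac)
  also have "(\<Sum>k\<in>{h<..2 * h}. f k) = (\<Sum>k<h. f (2 * h - k))"
    by (rule sum.reindex_bij_witness[of _ "\<lambda>k. 2 * h - k" "\<lambda>k. 2 * h - k"]) auto
  finally show ?thesis by (simp add: sum.distrib add_ac)
qed

lemma coprime_less_prime:
  fixes p m :: nat
  assumes "prime p" "0 < m" "m < p"
  shows "coprime (int m) (int p)" "coprime (int m) (int p ^ 2)"
proof -
  have "coprime p m" using assms by (intro prime_imp_coprime) (auto dest: dvd_imp_le)
  then show "coprime (int m) (int p)" by (simp add: coprime_commute)
  then show "coprime (int m) (int p ^ 2)" by simp
qed

section \<open>Column sums of squared binomial coefficients\<close>

definition column_square_sum :: "nat \<Rightarrow> nat \<Rightarrow> nat" where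
  "column_square_sum p k = (\<Sum>n<p. (n choose k)^2)"

text \<open>Summation by parts: with \<open>g n = (n + i choose Suc a)\<close> and \<open>f n = (n choose Suc d)\<close> the two
  summands are \<open>(g (n + 1) - g n) * f n\<close> and \<open>g (n + 1) * (f (n + 1) - f n)\<close>. The assumption makes
  \<open>g 0\<close> vanish, so that only the upper boundary term remains.\<close>
lemma choose_abel_summation:
  assumes "i \<le> a"
  shows "(\<Sum>n<N. (n + i choose a) * (n choose Suc d)) + (\<Sum>n<N. (n + Suc i choose Suc a) * (n choose d))
         = (N + i choose Suc a) * (N choose Suc d)"
  using assms by (induction N) (simp_all add: algebra_simps)

lemma sum_shifted_choose:
  assumes "i \<le> a"
  shows "(\<Sum>n<N. n + i choose a) = (N + i choose Suc a)"
  using assms by (induction N) simp_all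

text \<open>The numerator \<open>(p + i) \<dots> (p + i - m + 1)\<close> contains the factor \<open>p\<close>, and \<open>m!\<close> does not.\<close>
lemma prime_dvd_choose_carry:
  fixes p :: nat
  assumes "prime p" "i < m" "m < p"
  shows "p dvd (p + i choose m)"
proof -
  have "fact m * fact (p + i - m) * (p + i choose m) = fact (p + i)"
    using assms by (intro binomial_fact_lemma) simp
  moreover have "p dvd fact (p + i)" "\<not> p dvd fact m" "\<not> p dvd fact (p + i - m)"
    using assms by (auto simp: prime_dvd_fact_iff)
  ultimately show ?thesis using assms by (metis prime_dvd_mult_iff)
qed

text \<open>The sums \<open>U i\<close> interpolate between \<open>T\<^sub>k = U 0\<close> and the hockey-stick sum \<open>U k\<close>. Both factors
  of the boundary term of each summation by parts are divisible by \<open>p\<close>; the bound \<open>2k < p\<close> ensures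
  this up to the last step, whose boundary term involves \<open>(p + k - 1 choose 2k)\<close>.\<close>
lemma column_square_sum_cong_choose:
  fixes p :: nat
  assumes "prime p" "2 * k < p"
  shows "[int (column_square_sum p k) = (-1)^k * int (p + k choose (2 * k + 1))] (mod int p ^ 2)"
proof -
  define U where "U i = int (\<Sum>n<p. (n + i choose (k + i)) * (n choose (k - i)))" for i
  have step: "[U i = - U (Suc i)] (mod int p ^ 2)" if "i < k" for i
  proof -
    have "U i + U (Suc i) = int ((p + i choose Suc (k + i)) * (p choose (k - i)))"
      unfolding U_def of_nat_add[symmetric]
      using choose_abel_summation[where i = i and a = "k + i" and N = p and d = "k - Suc i"] that by (simp add: Suc_diff_Suc)
    moreover have "p dvd (p + i choose Suc (k + i))"
      using assms that by (intro prime_dvd_choose_carry) auto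
    moreover have "p dvd (p choose (k - i))"
      using assms that by (intro dvd_choose_prime) auto
    ultimately have "int p ^ 2 dvd U i - (- U (Suc i))"
      by (simp add: power2_eq_square mult_dvd_mono)
    then show ?thesis by (simp add: cong_iff_dvd_diff)
  qed
  have "[U 0 = (-1)^i * U i] (mod int p ^ 2)" if "i \<le> k" for i
    using that
  proof (induction i)
    case (Suc i)
    then have "[U 0 = (-1)^i * U i] (mod int p ^ 2)" by simp
    also have "[(-1)^i * U i = (-1)^i * (- U (Suc i))] (mod int p ^ 2)"
      using step[of i] Suc.prems by (intro cong_mult cong_refl) auto
    finally show ?case by simp
  qed simp
  from this[of k] show ?thesis
    using sum_shifted_choose[of k "k + k" p]
    by (simp add: U_def column_square_sum_def power2_eq_square mult_2)
qed

section \<open>Binomial coefficients near a prime\<close>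

text \<open>Modulo \<open>p\<close> the upper index \<open>p - 1 - s\<close> may be read as \<open>-1 - s\<close>, and this is upper negation.\<close>
lemma choose_reflection_cong:
  fixes p :: nat
  assumes "prime p" "s + r < p"
  shows "[int (p - 1 - s choose r) = (-1)^r * int (s + r choose r)] (mod int p)"
  using assms(2)
proof (induction r arbitrary: s)
  case (Suc r)
  have IH: "[int (p - 1 - Suc s choose r) = (-1)^r * int (Suc s + r choose r)] (mod int p)"
    using Suc.IH[of "Suc s"] Suc.prems by simp
  have "Suc r * (p - 1 - s choose Suc r) = (p - 1 - s) * (p - 1 - Suc s choose r)"
    using times_binomial_minus1_eq[of "Suc r" "p - 1 - s"] by simp
  then have "int (Suc r) * int (p - 1 - s choose Suc r) = int (p - 1 - s) * int (p - 1 - Suc s choose r)"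
    by (metis of_nat_mult)
  also have "[\<dots> = - int (Suc s) * ((-1)^r * int (Suc s + r choose r))] (mod int p)"
    using Suc.prems by (intro cong_mult IH) (simp add: cong_iff_dvd_diff)
  also have "- int (Suc s) * ((-1)^r * int (Suc s + r choose r))
             = int (Suc r) * ((-1)^Suc r * int (s + Suc r choose Suc r))"
  proof -
    have "Suc r * (s + Suc r choose Suc r) = Suc s * (Suc s + r choose r)"
      using Suc_times_binomial_add[of r s] by (simp add: add.commute)
    then have "int (Suc r) * int (s + Suc r choose Suc r) = int (Suc s) * int (Suc s + r choose r)"
      by (metis of_nat_mult)
    then show ?thesis by (simp add: mult_ac del: of_nat_Suc binomial_Suc_Suc)
  qed
  finally have "[int (Suc r) * int (p - 1 - s choose Suc r)
                 = int (Suc r) * ((-1)^Suc r * int (s + Suc r choose Suc r))] (mod int p)" .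
  moreover have "coprime (int (Suc r)) (int p)"
    using coprime_less_prime(1)[OF assms(1), of "Suc r"] Suc.prems by simp
  ultimately show ?case by (simp only: cong_mult_lcancel)
qed simp

lemma choose_prime_plus_cong_1:
  fixes p :: nat
  assumes "prime p" "r < p"
  shows "[int (p + r choose r) = 1] (mod int p)"
  using assms(2)
proof (induction r)
  case (Suc r)
  have "int (Suc r) * int (p + Suc r choose Suc r) = int (p + Suc r) * int (p + r choose r)"
    by (metis Suc_times_binomial add_Suc_right of_nat_mult)
  also have "[\<dots> = int (Suc r) * 1] (mod int p)"
    using Suc by (intro cong_mult) (simp_all add: cong_iff_dvd_diff)
  finally show ?case
    using coprime_less_prime(1)[OF assms(1) _ Suc.prems] by (simp only: cong_mult_lcancel zero_less_Suc)
qed simp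

text \<open>The product is \<open>\<Prod>\<^sub>i\<^sub>\<le>\<^sub>k (p - i)(p + i) / i\<^sup>2\<close>: the terms linear in \<open>p\<close> cancel in pairs,
  which is why a congruence modulo \<open>p\<^sup>2\<close> holds although each factor is controlled only modulo \<open>p\<close>.\<close>
lemma choose_pred_times_choose_plus_cong:
  fixes p :: nat
  assumes "prime p" "k < p"
  shows "[int (p - 1 choose k) * int (p + k choose k) = (-1)^k] (mod int p ^ 2)"
  using assms(2)
proof (induction k)
  case (Suc k)
  have 1: "int (Suc k) * int (p + Suc k choose Suc k) = int (p + Suc k) * int (p + k choose k)"
    by (metis Suc_times_binomial add_Suc_right of_nat_mult)
  have "Suc k * (p - 1 choose Suc k) = (p - 1 - k) * (p - 1 choose k)"
    by (metis binomial_absorb_comp binomial_absorption)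
  then have 2: "int (Suc k) * int (p - 1 choose Suc k) = (int p - int (Suc k)) * int (p - 1 choose k)"
    using Suc.prems by (simp flip: of_nat_mult of_nat_Suc of_nat_diff)
  have "int (Suc k) ^ 2 * (int (p - 1 choose Suc k) * int (p + Suc k choose Suc k))
      = (int (Suc k) * int (p - 1 choose Suc k)) * (int (Suc k) * int (p + Suc k choose Suc k))"
    by (simp add: power2_eq_square)
  also have "\<dots> = (int p ^ 2 - int (Suc k) ^ 2) * (int (p - 1 choose k) * int (p + k choose k))"
    unfolding 1 2 of_nat_add
    by (simp add: algebra_simps power2_eq_square del: of_nat_Suc binomial_Suc_Suc)
  also have "[\<dots> = (- (int (Suc k) ^ 2)) * (-1)^k] (mod int p ^ 2)"
    using Suc by (intro cong_mult) (simp_all add: cong_iff_dvd_diff)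
  finally have "[int (Suc k) ^ 2 * (int (p - 1 choose Suc k) * int (p + Suc k choose Suc k))
                 = int (Suc k) ^ 2 * (-1)^Suc k] (mod int p ^ 2)" by simp
  moreover have "coprime (int (Suc k) ^ 2) (int p ^ 2)"
    using coprime_less_prime(2)[OF assms(1), of "Suc k"] Suc.prems by (simp del: of_nat_Suc)
  ultimately show ?case by (metis cong_mult_lcancel)
qed simp

text \<open>Only rows \<open>n = p - 1 - s\<close> with \<open>s \<le> i\<close> reach column \<open>p - 1 - i\<close>, and reflection identifies their
  entries up to sign with row \<open>i\<close> of Pascal's triangle.\<close>
lemma column_square_sum_cong_central:
  fixes p :: nat
  assumes "prime p" "2 * i < p"
  shows "[int (column_square_sum p (p - 1 - i)) = int (2 * i choose i)] (mod int p)"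
proof -
  let ?f = "\<lambda>n. int (n choose (p - 1 - i)) ^ 2"
  have "int (column_square_sum p (p - 1 - i)) = (\<Sum>n<p. ?f n)"
    by (simp add: column_square_sum_def)
  also have "\<dots> = (\<Sum>n\<in>{p - 1 - i..<p}. ?f n)"
    by (rule sum.mono_neutral_right) auto
  also have "\<dots> = (\<Sum>s\<le>i. ?f (p - 1 - s))"
    using assms(2)
    by (intro sum.reindex_bij_witness[of _ "\<lambda>s. p - 1 - s" "\<lambda>n. p - 1 - n"]) auto
  also have "[\<dots> = (\<Sum>s\<le>i. int (i choose s) ^ 2)] (mod int p)"
  proof (rule cong_sum)
    fix s assume "s \<in> {..i}"
    then have s: "s \<le> i" by simp
    have "(p - 1 - s choose (p - 1 - i)) = (p - 1 - s choose (i - s))"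
      using s assms(2) by (subst binomial_symmetric) auto
    moreover have "(i choose (i - s)) = (i choose s)"
      using s by (simp flip: binomial_symmetric)
    ultimately have "[int (p - 1 - s choose (p - 1 - i)) = (-1)^(i - s) * int (i choose s)] (mod int p)"
      using choose_reflection_cong[OF assms(1), of s "i - s"] s assms(2) by simp
    then have "[?f (p - 1 - s) = ((-1)^(i - s) * int (i choose s))^2] (mod int p)"
      by (rule cong_pow)
    then show "[?f (p - 1 - s) = int (i choose s) ^ 2] (mod int p)"
      by (simp add: power_mult_distrib flip: power_mult)
  qed
  also have "(\<Sum>s\<le>i. int (i choose s) ^ 2) = int (2 * i choose i)"
    by (simp flip: choose_square_sum)
  finally show ?thesis .
qed

text \<open>Put \<open>k = p - 1 - i\<close>. Since \<open>p\<close> divides \<open>(2k choose k)\<close>, the factor \<open>(2i choose i)\<close> may be replaced by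
  its reflection \<open>(-1)\<^sup>i (k choose i)\<close>. Then the product of \<open>(2k choose k)\<close> and \<open>(k choose i)\<close> regroups as
  \<open>(2k choose p - 1)\<close> times \<open>(p - 1 choose i)\<close>. The last factor is \<open>(-1)\<^sup>i\<close> modulo \<open>p\<close>. As
  \<open>2k = p + r\<close> with \<open>r + 1 = p - (2i + 1)\<close>, absorption evaluates the other one as
  \<open>p (p + r choose r) / (r + 1)\<close>, which is \<open>-p / (2i + 1)\<close> modulo \<open>p\<^sup>2\<close>.\<close>
lemma central_choose_complement_cong:
  fixes p :: nat
  assumes "prime p" "2 * i + 1 < p"
  shows "int p dvd int (2 * (p - 1 - i) choose (p - 1 - i))"
    and "[int (2 * i + 1) * (int (2 * i choose i) * int (2 * (p - 1 - i) choose (p - 1 - i))) = - int p]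
         (mod int p ^ 2)"
proof -
  define k where "k = p - 1 - i"
  define r where "r = p - 2 - 2 * i"
  have k: "2 * k = p + r" "k + i = p - 1" "k < p" "r < k" using assms(2) by (auto simp: k_def r_def)
  have "p dvd (2 * k choose k)"
    using prime_dvd_choose_carry[OF assms(1), of r k] k by simp
  then show dvd: "int p dvd int (2 * (p - 1 - i) choose (p - 1 - i))"
    by (simp add: k_def)
  have A: "(2 * k choose k) * (k choose i) = (2 * k choose (p - 1)) * (p - 1 choose i)"
  proof -
    have "(2 * k choose (p - 1)) * (p - 1 choose k) = (2 * k choose k) * (2 * k - k choose (p - 1 - k))"
      using k by (intro choose_mult) auto
    moreover have "(p - 1 choose k) = (p - 1 choose i)" "p - 1 - k = i"
      using k by (metis add_diff_cancel_left' binomial_symmetric le_add1, simp)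
    ultimately show ?thesis by simp
  qed
  have B: "int (Suc r) * int (2 * k choose (p - 1)) = int p * int (p + r choose r)"
  proof -
    have "(2 * k choose (p - 1)) = (p + r choose Suc r)"
      using k assms(2) by (subst binomial_symmetric) auto
    moreover have "Suc r * (p + r choose Suc r) = p * (p + r choose r)"
      by (metis add_diff_cancel_right' binomial_absorb_comp binomial_absorption)
    ultimately show ?thesis by (metis of_nat_mult)
  qed
  have pd: "int p dvd int (2 * k choose (p - 1))"
  proof -
    have "int p dvd int (Suc r) * int (2 * k choose (p - 1))" unfolding B by simp
    moreover have "coprime (int p) (int (Suc r))"
      using coprime_less_prime(1)[OF assms(1), of "Suc r"] k by (simp add: coprime_commute)
    ultimately show ?thesis by (simp add: coprime_dvd_mult_right_iff)
  qed
  have refl: "[int (2 * i choose i) = (-1)^i * int (k choose i)] (mod int p)"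
  proof -
    have "[(-1)^i * int (k choose i) = (-1)^i * ((-1)^i * int (2 * i choose i))] (mod int p)"
      using choose_reflection_cong[OF assms(1), of i i] assms(2)
      by (intro cong_mult cong_refl) (simp add: k_def mult_2)
    then show ?thesis by (simp add: cong_sym flip: mult.assoc power_add mult_2)
  qed
  have "[int (2 * k choose k) * int (2 * i choose i) = int (2 * k choose k) * ((-1)^i * int (k choose i))]
        (mod int p ^ 2)"
    using dvd by (intro cong_mult_dvd_square_modulus refl) (simp add: k_def)
  also have "int (2 * k choose k) * ((-1)^i * int (k choose i))
             = int (2 * k choose (p - 1)) * ((-1)^i * int (p - 1 choose i))"
    using arg_cong[OF A, of int] by (simp add: mult_ac)
  also have "[\<dots> = int (2 * k choose (p - 1)) * 1] (mod int p ^ 2)"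
  proof (intro cong_mult_dvd_square_modulus pd)
    have "[(-1)^i * int (p - 1 choose i) = (-1)^i * (-1)^i] (mod int p)"
      using choose_reflection_cong[OF assms(1), of 0 i] assms(2) by (intro cong_mult cong_refl) simp
    then show "[(-1)^i * int (p - 1 choose i) = 1] (mod int p)"
      by (simp flip: power_add mult_2)
  qed
  finally have C: "[int (2 * k choose k) * int (2 * i choose i) = int (2 * k choose (p - 1))] (mod int p ^ 2)"
    by simp
  have "[int (2 * i + 1) * (int (2 * k choose k) * int (2 * i choose i))
         = int (2 * i + 1) * int (2 * k choose (p - 1))] (mod int p ^ 2)"
    by (intro cong_mult cong_refl C)
  also have "int (2 * i + 1) * int (2 * k choose (p - 1)) = int (2 * k choose (p - 1)) * int (2 * i + 1)"
    by simp
  also have "[\<dots> = int (2 * k choose (p - 1)) * (- int (Suc r))] (mod int p ^ 2)"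
    using assms(2) by (intro cong_mult_dvd_square_modulus pd) (simp add: cong_iff_dvd_diff r_def)
  also have "int (2 * k choose (p - 1)) * (- int (Suc r)) = int p * (- int (p + r choose r))"
    using B by (simp add: algebra_simps)
  also have "[\<dots> = int p * (- 1)] (mod int p ^ 2)"
    using choose_prime_plus_cong_1[OF assms(1), of r] k
    by (intro cong_mult_dvd_square_modulus) (auto simp: cong_minus_minus_iff)
  finally show "[int (2 * i + 1) * (int (2 * i choose i) * int (2 * (p - 1 - i) choose (p - 1 - i))) = - int p]
         (mod int p ^ 2)"
    by (simp add: k_def mult_ac)
qed

section \<open>The contribution of each Catalan number\<close>

definition catalan_term :: "nat \<Rightarrow> nat \<Rightarrow> int" where
  "catalan_term p k = int (catalan k * column_square_sum p k)"

lemma sum_catalan_sum_eq: "int (\<Sum>n<p. catalan_sum n) = (\<Sum>k<p. catalan_term p k)"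
proof -
  have "(\<Sum>n<p. catalan_sum n) = (\<Sum>n<p. \<Sum>k<p. (n choose k)^2 * catalan k)"
    unfolding catalan_sum_def by (intro sum.cong refl sum.mono_neutral_left) auto
  also have "\<dots> = (\<Sum>k<p. \<Sum>n<p. (n choose k)^2 * catalan k)"
    by (rule sum.swap)
  also have "\<dots> = (\<Sum>k<p. catalan k * column_square_sum p k)"
    by (simp add: column_square_sum_def mult.commute sum_distrib_left)
  finally show ?thesis by (simp add: catalan_term_def)
qed

lemma Suc_times_catalan_term:
  "int (k + 1) * catalan_term p k = int (2 * k choose k) * int (column_square_sum p k)"
  unfolding catalan_term_def by (metis Suc_times_catalan mult.assoc of_nat_mult)

text \<open>Summation by parts leaves \<open>(2k choose k) (p + k choose 2k + 1)\<close>. Its \<open>(2k + 1)\<close>-fold is exactly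
  \<open>p\<close> times the product \<open>(p - 1 choose k) (p + k choose k)\<close>, which is a sign modulo \<open>p\<^sup>2\<close>.\<close>
lemma catalan_term_below_half_cong:
  fixes p :: nat
  assumes "prime p" "2 * k + 1 < p"
  shows "[int (k + 1) * int (2 * k + 1) * catalan_term p k = int p] (mod int p ^ 2)"
proof -
  have closed: "(2 * k + 1) * ((2 * k choose k) * (p + k choose (2 * k + 1)))
                = p * ((p - 1 choose k) * (p + k choose k))"
  proof -
    have 1: "Suc (2 * k) * (2 * k choose k) = Suc k * (Suc (2 * k) choose k)"
      using Suc_times_binomial_add[of k k] Suc_times_binomial[of k "2 * k"] by (simp add: mult_2)
    have "(p + k choose (2 * k + 1)) * (2 * k + 1 choose k)
          = (p + k choose k) * (p + k - k choose (2 * k + 1 - k))"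
      using assms(2) by (intro choose_mult) auto
    then have 2: "(p + k choose Suc (2 * k)) * (Suc (2 * k) choose k) = (p + k choose k) * (p choose Suc k)"
      by (simp add: mult_2)
    have 3: "Suc k * (p choose Suc k) = p * (p - 1 choose k)"
      by (metis binomial_absorption)
    have "(2 * k + 1) * ((2 * k choose k) * (p + k choose (2 * k + 1)))
          = (Suc (2 * k) * (2 * k choose k)) * (p + k choose Suc (2 * k))"
      by (simp only: Suc_eq_plus1 mult_ac)
    also have "\<dots> = Suc k * ((p + k choose Suc (2 * k)) * (Suc (2 * k) choose k))"
      unfolding 1 by (simp only: mult_ac)
    also have "\<dots> = (Suc k * (p choose Suc k)) * (p + k choose k)"
      unfolding 2 by (simp only: mult_ac)
    finally show ?thesis unfolding 3 by (simp only: mult_ac)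
  qed
  have "int (k + 1) * int (2 * k + 1) * catalan_term p k
        = int (2 * k + 1) * int (2 * k choose k) * int (column_square_sum p k)"
    using Suc_times_catalan_term[of k p] by (metis mult.assoc mult.commute)
  also have "[\<dots> = int (2 * k + 1) * int (2 * k choose k) * ((-1)^k * int (p + k choose (2 * k + 1)))]
             (mod int p ^ 2)"
    using assms by (intro cong_mult cong_refl column_square_sum_cong_choose) auto
  also have "int (2 * k + 1) * int (2 * k choose k) * ((-1)^k * int (p + k choose (2 * k + 1)))
             = int p * (-1)^k * (int (p - 1 choose k) * int (p + k choose k))"
    using arg_cong[OF closed, of int] by (simp only: of_nat_mult mult_ac)
  also have "[\<dots> = int p * (-1)^k * (-1)^k] (mod int p ^ 2)"
    using assms by (intro cong_mult cong_refl choose_pred_times_choose_plus_cong) auto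
  finally show ?thesis by (simp add: mult.assoc flip: power_add mult_2)
qed

text \<open>In the middle column \<open>2k + 1 = p\<close>, so the factor \<open>p\<close> of the preceding evaluation cancels and
  \<open>(h + 1) x\<^sub>h \<equiv> 1\<close> remains. Since \<open>2(h + 1) = p + 1\<close>, the inverse of \<open>h + 1\<close> modulo \<open>p\<^sup>2\<close> is
  \<open>2(1 - p)\<close>.\<close>
lemma catalan_term_half_cong:
  fixes p :: nat
  assumes "prime p" "p = 2 * h + 1"
  shows "[catalan_term p h = 2 - 2 * int p] (mod int p ^ 2)"
proof -
  have "int (h + 1) * catalan_term p h = int (2 * h choose h) * int (column_square_sum p h)"
    by (rule Suc_times_catalan_term)
  also have "[\<dots> = int (2 * h choose h) * ((-1)^h * int (p + h choose (2 * h + 1)))] (mod int p ^ 2)"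
    using assms by (intro cong_mult cong_refl column_square_sum_cong_choose) auto
  also have "int (2 * h choose h) * ((-1)^h * int (p + h choose (2 * h + 1)))
             = (-1)^h * (int (p - 1 choose h) * int (p + h choose h))"
    using binomial_symmetric[of p "p + h"] assms(2) by simp
  also have "[\<dots> = (-1)^h * (-1)^h] (mod int p ^ 2)"
    using assms by (intro cong_mult cong_refl choose_pred_times_choose_plus_cong) auto
  finally have "[int (h + 1) * catalan_term p h = 1] (mod int p ^ 2)"
    by (simp flip: power_add mult_2)
  then have "[2 * (1 - int p) * (int (h + 1) * catalan_term p h) = 2 * (1 - int p) * 1] (mod int p ^ 2)"
    by (intro cong_mult cong_refl)
  moreover have "2 * (1 - int p) * (int (h + 1) * catalan_term p h)
                 = catalan_term p h + int p ^ 2 * (- catalan_term p h)"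
    using assms(2) by (simp add: algebra_simps power2_eq_square)
  ultimately have "[catalan_term p h + int p ^ 2 * (- catalan_term p h) = 2 * (1 - int p) * 1] (mod int p ^ 2)"
    by simp
  moreover have "2 * (1 - int p) * 1 = 2 - 2 * int p" by simp
  ultimately show ?thesis by (simp only: cong_def mod_mult_self2)
qed

text \<open>The Catalan number has denominator \<open>p - i\<close>, which may be replaced by \<open>-i\<close> because \<open>p\<close> divides the
  term.\<close>
lemma catalan_term_above_half_cong:
  fixes p :: nat
  assumes "prime p" "0 < i" "2 * i + 1 < p"
  shows "[int i * int (2 * i + 1) * catalan_term p (p - 1 - i) = int p] (mod int p ^ 2)"
proof -
  let ?k = "p - 1 - i"
  have k: "int (?k + 1) = int p - int i" using assms(3) by simp
  have "int (2 * i + 1) * (int (?k + 1) * catalan_term p ?k)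
        = int (2 * i + 1) * (int (2 * ?k choose ?k) * int (column_square_sum p ?k))"
    by (simp only: Suc_times_catalan_term)
  also have "[\<dots> = int (2 * i + 1) * (int (2 * ?k choose ?k) * int (2 * i choose i))] (mod int p ^ 2)"
    using assms
    by (intro cong_mult[OF cong_refl] cong_mult_dvd_square_modulus central_choose_complement_cong(1)
              column_square_sum_cong_central) auto
  also have "int (2 * i + 1) * (int (2 * ?k choose ?k) * int (2 * i choose i))
             = int (2 * i + 1) * (int (2 * i choose i) * int (2 * ?k choose ?k))"
    by (simp only: mult_ac)
  also have "[\<dots> = - int p] (mod int p ^ 2)"
    using assms by (intro central_choose_complement_cong(2)) auto
  finally have main: "[int (2 * i + 1) * ((int p - int i) * catalan_term p ?k) = - int p] (mod int p ^ 2)"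
    by (simp only: k)
  have "int p dvd catalan_term p ?k"
  proof -
    have "int p dvd int (?k + 1) * catalan_term p ?k"
      unfolding Suc_times_catalan_term
      using assms by (intro dvd_mult2 central_choose_complement_cong(1)) auto
    moreover have "coprime (int p) (int (?k + 1))"
      using coprime_less_prime(1)[OF assms(1), of "?k + 1"] assms by (simp add: coprime_commute)
    ultimately show ?thesis by (simp only: coprime_dvd_mult_right_iff)
  qed
  then have "[int p * catalan_term p ?k = 0] (mod int p ^ 2)"
    by (simp add: cong_0_iff power2_eq_square)
  then have "[int (2 * i + 1) * (int p * catalan_term p ?k) - int (2 * i + 1) * ((int p - int i) * catalan_term p ?k)
         = int (2 * i + 1) * 0 - (- int p)] (mod int p ^ 2)"
    using main by (intro cong_diff cong_mult cong_refl)
  then show ?thesis by (simp add: algebra_simps)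
qed

text \<open>Here the denominator of the Catalan number is \<open>p\<close> itself, so its central binomial coefficient
  would have to be known modulo \<open>p\<^sup>3\<close>. Instead \<open>(2p choose p) = 2 (2p - 1) C\<^sub>p\<^sub>-\<^sub>1\<close> is
  used, where \<open>(2p choose p)\<close> is the sum of the squares in row \<open>p\<close> and hence \<open>2\<close> modulo \<open>p\<^sup>2\<close>. The
  inverse of \<open>2p - 1\<close> modulo \<open>p\<^sup>2\<close> is \<open>-1 - 2p\<close>.\<close>
lemma catalan_term_last_cong:
  fixes p :: nat
  assumes "prime p" "2 < p"
  shows "[catalan_term p (p - 1) = - 1 - 2 * int p] (mod int p ^ 2)"
proof -
  obtain q where q: "p = Suc q" using prime_gt_0_nat[OF assms(1)] gr0_implies_Suc by blast
  have "column_square_sum p q = 1" by (simp add: column_square_sum_def q)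
  then have x: "catalan_term p q = int (catalan q)" by (simp add: catalan_term_def)
  have "Suc q * (Suc (2 * q) choose Suc q) = Suc q * (Suc (2 * q) * catalan q)"
    by (metis Suc_times_binomial Suc_times_catalan Suc_eq_plus1 mult.left_commute)
  then have "(Suc (2 * q) choose Suc q) = Suc (2 * q) * catalan q"
    by (simp only: mult_cancel1) simp
  moreover have "(2 * p choose p) = 2 * (Suc (2 * q) choose Suc q)"
    using central_binomial_odd[of "Suc (2 * q)"] binomial_symmetric[of q "Suc (2 * q)"] by (simp add: q)
  ultimately have central: "int (2 * p choose p) = 2 * ((2 * int p - 1) * catalan_term p q)"
    unfolding x by (simp add: q algebra_simps)
  have "int (2 * p choose p) = (\<Sum>j\<le>p. int (p choose j) ^ 2)"
    by (simp flip: choose_square_sum)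
  also have "{..p} = insert 0 (insert p {0<..<p})" by auto
  also have "(\<Sum>j\<in>\<dots>. int (p choose j) ^ 2) = 2 + (\<Sum>j\<in>{0<..<p}. int (p choose j) ^ 2)"
    using q by simp
  also have "[\<dots> = 2 + 0] (mod int p ^ 2)"
    using assms by (intro cong_add cong_refl) (auto simp: cong_0_iff intro!: dvd_sum dvd_power_same dvd_choose_prime)
  finally have "[2 * ((2 * int p - 1) * catalan_term p q) = 2 * 1] (mod int p ^ 2)"
    by (simp add: central)
  moreover have "coprime (2::int) (int p ^ 2)"
    using coprime_less_prime(2)[OF assms(1), of 2] assms(2) by simp
  ultimately have "[(2 * int p - 1) * catalan_term p q = 1] (mod int p ^ 2)"
    by (simp only: cong_mult_lcancel)
  then have "[(- 1 - 2 * int p) * ((2 * int p - 1) * catalan_term p q) = (- 1 - 2 * int p) * 1] (mod int p ^ 2)"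
    by (intro cong_mult cong_refl)
  moreover have "(- 1 - 2 * int p) * ((2 * int p - 1) * catalan_term p q)
                 = catalan_term p q + int p ^ 2 * (- 4 * catalan_term p q)"
    by (simp add: algebra_simps power2_eq_square)
  ultimately have "[catalan_term p q + int p ^ 2 * (- 4 * catalan_term p q) = - 1 - 2 * int p] (mod int p ^ 2)"
    by simp
  then have "[catalan_term p q = - 1 - 2 * int p] (mod int p ^ 2)"
    by (simp only: cong_def mod_mult_self2)
  then show ?thesis by (simp add: q)
qed

section \<open>Summation over all columns\<close>

text \<open>Since \<open>1 / ((i + 1)(2i + 1)) + 1 / (i(2i + 1)) = 1 / (i(i + 1))\<close>, each pair contributes
  \<open>p (1/i - 1/(i + 1))\<close>, and the sum up to \<open>m\<close> telescopes to \<open>p (1 - 1/m)\<close>.\<close>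
lemma sum_catalan_term_pairs_cong:
  fixes p :: nat
  assumes "prime p" "p = 2 * h + 1" "0 < m" "m \<le> h"
  shows "[int m * (\<Sum>i\<in>{1..<m}. catalan_term p i + catalan_term p (2 * h - i)) = (int m - 1) * int p]
         (mod int p ^ 2)"
  using assms(3,4)
proof (induction m rule: nat_induct_non_zero)
  case (Suc m)
  let ?S = "\<Sum>i\<in>{1..<m}. catalan_term p i + catalan_term p (2 * h - i)"
  let ?x = "catalan_term p m" and ?y = "catalan_term p (2 * h - m)"
  have "[int m * (int (m + 1) * int (2 * m + 1) * ?x) + int (m + 1) * (int m * int (2 * m + 1) * ?y)
         = int m * int p + int (m + 1) * int p] (mod int p ^ 2)"
    using catalan_term_below_half_cong[OF assms(1), of m] catalan_term_above_half_cong[OF assms(1), of m]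
      Suc assms(2)
    by (intro cong_add cong_mult cong_refl) auto
  then have "[int (2 * m + 1) * (int m * int (m + 1) * (?x + ?y)) = int (2 * m + 1) * int p] (mod int p ^ 2)"
    by (simp add: algebra_simps)
  moreover have "coprime (int (2 * m + 1)) (int p ^ 2)"
    using Suc assms(2) by (intro coprime_less_prime assms) auto
  ultimately have pair: "[int m * int (m + 1) * (?x + ?y) = int p] (mod int p ^ 2)"
    by (simp only: cong_mult_lcancel)
  have "{1..<Suc m} = insert m {1..<m}" using Suc by auto
  then have "int m * (int (Suc m) * (\<Sum>i\<in>{1..<Suc m}. catalan_term p i + catalan_term p (2 * h - i)))
        = int (Suc m) * (int m * ?S) + int m * int (m + 1) * (?x + ?y)"
    by (simp add: algebra_simps)
  also have "[\<dots> = int (Suc m) * ((int m - 1) * int p) + int p] (mod int p ^ 2)"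
    by (rule cong_add[OF cong_mult[OF cong_refl Suc.IH] pair]) (use Suc.prems in simp)
  also have "int (Suc m) * ((int m - 1) * int p) + int p = int m * ((int (Suc m) - 1) * int p)"
    by (simp add: algebra_simps)
  finally show ?case
    using coprime_less_prime(2)[OF assms(1), of m] Suc assms(2) by (simp add: cong_mult_lcancel)
qed simp

theorem corollary1p5:
  fixes p :: nat
  assumes "prime p" and "odd p"
  shows "[(\<Sum>n = 1..p - 1. catalan_sum n) = 0] (mod p^2)"
proof -
  obtain h where h: "p = 2 * h + 1" using assms(2) by (auto elim: oddE)
  have "0 < h" using h prime_gt_1_nat[OF assms(1)] by simp
  let ?z = "\<lambda>i. catalan_term p i + catalan_term p (2 * h - i)"
  define S where "S = (\<Sum>i\<in>{1..<h}. ?z i)"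
  have hS: "[int h * S = (int h - 1) * int p] (mod int p ^ 2)"
    unfolding S_def by (rule sum_catalan_term_pairs_cong) (use assms h \<open>0 < h\<close> in auto)
  have "[S = 3 * int p] (mod int p ^ 2)"
  proof -
    \<comment> \<open>\<open>- 2 (1 + p)\<close> is the inverse of \<open>h\<close> modulo \<open>p\<^sup>2\<close>, because \<open>- 2 h = 1 - p\<close>.\<close>
    have "[- 2 * (1 + int p) * (int h * S) = - 2 * (1 + int p) * ((int h - 1) * int p)] (mod int p ^ 2)"
      by (intro cong_mult cong_refl hS)
    moreover have "- 2 * (1 + int p) * (int h * S) = S + int p ^ 2 * (- S)"
      by (simp add: h algebra_simps power2_eq_square)
    moreover have "- 2 * (1 + int p) * ((int h - 1) * int p) = 3 * int p + int p ^ 2 * (2 - int p)"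
      by (simp add: h algebra_simps power2_eq_square)
    ultimately have "[S + int p ^ 2 * (- S) = 3 * int p + int p ^ 2 * (2 - int p)] (mod int p ^ 2)"
      by simp
    then show ?thesis by (simp only: cong_def mod_mult_self2)
  qed
  moreover have "[catalan_term p 0 = int p] (mod int p ^ 2)"
    using catalan_term_below_half_cong[OF assms(1), of 0] h \<open>0 < h\<close> by simp
  moreover have "[catalan_term p (2 * h) = - 1 - 2 * int p] (mod int p ^ 2)"
    using catalan_term_last_cong[OF assms(1)] h \<open>0 < h\<close> by simp
  moreover have "[catalan_term p h = 2 - 2 * int p] (mod int p ^ 2)"
    using assms(1) h by (rule catalan_term_half_cong)
  ultimately have "[catalan_term p 0 + catalan_term p (2 * h) + S + catalan_term p h
      = int p + (- 1 - 2 * int p) + 3 * int p + (2 - 2 * int p)] (mod int p ^ 2)"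
    by (intro cong_add)
  moreover have "int (\<Sum>n<p. catalan_sum n) = catalan_term p 0 + catalan_term p (2 * h) + S + catalan_term p h"
  proof -
    have "(\<Sum>k<p. catalan_term p k) = (\<Sum>k<h. ?z k) + catalan_term p h"
      using sum_pair_reflect[of "catalan_term p" h] by (simp only: h)
    also have "{..<h} = insert 0 {1..<h}" using \<open>0 < h\<close> by auto
    finally show ?thesis by (simp only: sum_catalan_sum_eq S_def) simp
  qed
  moreover have "(\<Sum>n<p. catalan_sum n) = 1 + (\<Sum>n = 1..p - 1. catalan_sum n)"
  proof -
    have "{..<p} = insert 0 {1..p - 1}" using h by auto
    then show ?thesis by (simp add: catalan_sum_def catalan_def)
  qed
  ultimately have "[1 + int (\<Sum>n = 1..p - 1. catalan_sum n) = 1 + 0] (mod int p ^ 2)"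
    by simp
  then have "[int (\<Sum>n = 1..p - 1. catalan_sum n) = int 0] (mod int (p ^ 2))"
    by (simp only: cong_add_lcancel of_nat_0 of_nat_power)
  then show ?thesis by (simp only: cong_int_iff)
qed

end
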